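(* For each finite non-empty family $\mathcal{H}$ of non-empty finite sets, with $E=\bigcup_{H\in\mathcal{H}}H$, there is a block configuration $\mathcal{B}$ of length $|\mathcal{H}|+|E|$ and size $2|\mathcal{H}|+|E|+\sum_{H\in\mathcal{H}}|H|$ such that $\mathrm{CTP}(\mathcal{B})$ and $\mathrm{PACK}(\mathcal{H})$ are affinely isomorphic.
   Context: A set may occur several times in the family $\mathcal{H}$ ($|\mathcal{H}|$ and sums over $\mathcal{H}$ count multiplicities). A packing in $\mathcal{H}$ is a sub-family of $\mathcal{H}$ in which each pair of (different) members has empty intersection. The set-packing polytope $\mathrm{PACK}(\mathcal{H})\subseteq\mathbb{R}^{\mathcal{H}}$ is the convex hull of the incidence vectors (in $\{0,1\}^{\mathcal{H}}$) of all packings in $\mathcal{H}$. $\mathbb{F}_2$ is the field with two elements. A block configuration in $\mathbb{F}_2^d$ ($d\ge1$) is a sequence $\mathcal{B}=(\mathcal{B}(1),\dots,\mathcal{B}(n))$ with $n\ge2$ of non-empty subsets (blocks) $\mathcal{B}(i)\subseteq\mathbb{F}_2^d$; $n$ is its length and $\sum_i|\mathcal{B}(i)|$ its size. A cyclic transversal of $\mathcal{B}$ is a sequence $\xi=(\xi(1),\dots,\xi(n))$ with $\xi(i)\in\mathcal{B}(i)$ and $\sum_{i=1}^n\xi(i)=0$ in $\mathbb{F}_2^d$. Its incidence vector is $x=(x^1,\dots,x^n)$, $x^i\in\{0,1\}^{\mathcal{B}(i)}$, with $x^i_\omega=1$ iff $\xi(i)=\omega$. The cyclic transversal polytope $\mathrm{CTP}(\mathcal{B})\subseteq\mathbb{R}^{\mathcal{B}(1)}\times\cdots\times\mathbb{R}^{\mathcal{B}(n)}$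 is the convex hull of the incidence vectors of all cyclic transversals of $\mathcal{B}$. *)

theory Defs
  imports
    "HOL-Analysis.Analysis"
    "HOL-Analysis.Finite_Function_Topology"
    "HOL-Library.Z2"
    "Jordan_Normal_Form.Matrix"
begin

text \<open>
  For a finite set \<open>S\<close> of coordinates, \<open>\<real>\<^sup>S\<close> is represented by the finitely supported functions
  (type \<^typ>\<open>'a \<Rightarrow>\<^sub>0 real\<close>, a real vector space) whose support lies in \<open>S\<close>.
  Convex combinations of elements of \<open>\<real>\<^sup>S\<close> stay in \<open>\<real>\<^sup>S\<close>.
\<close>

definition incidence_vector :: "'a set \<Rightarrow> ('a \<Rightarrow>\<^sub>0 real)" where
  "incidence_vector S = (\<Sum>s\<in>S. Poly_Mapping.single s 1)"

lemma lookup_incidence_vector: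
  assumes "finite S"
  shows "Poly_Mapping.lookup (incidence_vector S) s = (if s \<in> S then 1 else 0)"
  using assms
  by (simp add: incidence_vector_def lookup_sum lookup_single when_def)

text \<open>
  The affine map is defined on the whole ambient type. For polytopes in \<open>\<real>\<^sup>S\<close> and \<open>\<real>\<^sup>T\<close> this is
  the same as an affine map \<open>\<real>\<^sup>S \<rightarrow> \<real>\<^sup>T\<close> restricting to a bijection between the polytopes:
  affine maps on \<open>\<real>\<^sup>S\<close> extend by ignoring the other coordinates, and conversely one may restrict
  to \<open>\<real>\<^sup>S\<close> and project onto \<open>\<real>\<^sup>T\<close>.
\<close>

definition affinely_isomorphic :: "'a::real_vector set \<Rightarrow> 'b::real_vector set \<Rightarrow> bool" where
  "affinely_isomorphic P Q \<longleftrightarrow> (\<exists>L c. linear L \<and> bij_betw (\<lambda>x. L x + c) P Q)"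

text \<open>
  A family of sets, in which a set may occur several times, is an indexed family \<open>(H i)\<^sub>i\<^sub>\<in>\<^sub>I\<close>;
  a sub-family is given by a subset of \<open>I\<close>, and two occurrences of the same set are
  different members.
\<close>

definition packing :: "'i set \<Rightarrow> ('i \<Rightarrow> 'a set) \<Rightarrow> 'i set \<Rightarrow> bool" where
  "packing I H S \<longleftrightarrow> S \<subseteq> I \<and> disjoint_family_on H S"

definition PACK :: "'i set \<Rightarrow> ('i \<Rightarrow> 'a set) \<Rightarrow> ('i \<Rightarrow>\<^sub>0 real) set" where
  "PACK I H = convex hull (incidence_vector ` {S. packing I H S})"

text \<open>\<open>\<F>\<^sub>2\<^sup>d\<close> is \<^term>\<open>carrier_vec d :: bit vec set\<close>. Blocks are numbered from \<open>0\<close>.\<close>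

definition block_configuration :: "nat \<Rightarrow> bit vec set list \<Rightarrow> bool" where
  "block_configuration d B \<longleftrightarrow>
     1 \<le> d \<and> 2 \<le> length B \<and> (\<forall>b\<in>set B. b \<noteq> {} \<and> b \<subseteq> carrier_vec d)"

definition configuration_size :: "bit vec set list \<Rightarrow> nat" where
  "configuration_size B = (\<Sum>i<length B. card (B ! i))"

definition cyclic_transversal :: "nat \<Rightarrow> bit vec set list \<Rightarrow> bit vec list \<Rightarrow> bool" where
  "cyclic_transversal d B \<xi> \<longleftrightarrow>
     length \<xi> = length B \<and> (\<forall>i<length B. \<xi> ! i \<in> B ! i) \<and>
     finsum_vec TYPE(bit) d (\<lambda>i. \<xi> ! i) {..<length B} = 0\<^sub>v d"

text \<open>
  The coordinate \<open>x\<^sup>i\<^sub>\<omega>\<close> is indexed by the pair \<open>(i, \<omega>)\<close>, so the vector \<open>x\<close> of \<open>\<xi>\<close> has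
  ones exactly at the pairs \<open>(i, \<xi> ! i)\<close>.
\<close>

definition transversal_vector :: "bit vec list \<Rightarrow> (nat \<times> bit vec \<Rightarrow>\<^sub>0 real)" where
  "transversal_vector \<xi> = incidence_vector {(i, \<xi> ! i) |i. i < length \<xi>}"

definition CTP :: "nat \<Rightarrow> bit vec set list \<Rightarrow> (nat \<times> bit vec \<Rightarrow>\<^sub>0 real) set" where
  "CTP d B = convex hull (transversal_vector ` {\<xi>. cyclic_transversal d B \<xi>})"

end

theory Submission
  imports Defs
begin

text \<open>
  Take one coordinate of the binary space for each incidence \<open>(i, e)\<close>, \<open>e \<in> H i\<close>, so that vectors
  are sets of incidences. A member \<open>i\<close> of the family gets a block that offers the empty set and the
  whole row \<open>{i} \<times> H i\<close>: choosing the row means that \<open>i\<close> is taken. A ground element \<open>e\<close> gets a block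
  that offers the empty set and the single incidences \<open>{(i, e)}\<close>: the choice names the member, if
  any, that occupies \<open>e\<close>. The number of blocks and their total size are the required ones.

  The coordinate \<open>(i, e)\<close> occurs only in the block of \<open>i\<close> and in the block of \<open>e\<close>, so the chosen
  vectors sum to zero over the two-element field exactly when, for every incidence, the two blocks
  agree on it. Agreement says that every taken member occupies all of its elements and nobody else
  occupies any; since a block of \<open>e\<close> has room for one member only, the taken members form a packing,
  and this packing determines all the choices (\<open>cyclic_transversal_iff_packing\<close>).

  It remains to see that this bijection between vertices is affine in both directions, because
  mutually inverse affine maps between the vertex sets extend to the convex hulls
  (\<open>affinely_isomorphic_convex_hulls\<close>). From transversals to packings one reads off the
  coordinates that say which rows are chosen. Conversely, taking one more member of a packing
  changes the choice in blocks that no other member of the packing touches. Hence the vertex of a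
  packing is the vertex of the empty packing plus one difference vector for each member
  (\<open>transversal_vector_selection\<close>), an expression that is affine in the incidence vector of the
  packing.
\<close>

section \<open>Affine isomorphisms between convex hulls\<close>

lemma lookup_scaleR:
  "Poly_Mapping.lookup (c *\<^sub>R x) k = c * Poly_Mapping.lookup x k"
proof -
  have "finite {k. c *\<^sub>R Poly_Mapping.lookup x k \<noteq> 0}"
    by (rule finite_subset[OF _ finite_keys[of x]]) (auto simp: in_keys_iff)
  then show ?thesis by (simp add: scaleR_poly_mapping_def)
qed

lemma linear_sum_lookup:
  fixes a :: "'i \<Rightarrow> 'k" and v :: "'i \<Rightarrow> 'b::real_vector"
  shows "linear (\<lambda>x :: 'k \<Rightarrow>\<^sub>0 real. \<Sum>i\<in>I. Poly_Mapping.lookup x (a i) *\<^sub>R v i)"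
  by (rule linearI)
    (simp_all add: lookup_add lookup_scaleR algebra_simps sum.distrib scaleR_sum_right)

text \<open>
  The points that an affine map fixes form a convex set; applied to the composite of \<open>L\<close> with the
  affine map \<open>\<lambda>y. M y + c\<close>, this makes \<open>L\<close> injective on the whole hull of \<open>V\<close>.
\<close>

lemma affinely_isomorphic_convex_hulls:
  fixes L :: "'a::real_vector \<Rightarrow> 'b::real_vector" and M :: "'b \<Rightarrow> 'a"
  assumes L: "linear L" and M: "linear M"
    and img: "L ` V = W" and inv: "\<And>v. v \<in> V \<Longrightarrow> M (L v) + c = v"
  shows "affinely_isomorphic (convex hull V) (convex hull W)"
proof -
  have "convex {x. M (L x) + c = x}"
  proof (rule convexI, goal_cases)
    case (1 x y u v)
    then have x: "M (L x) = x - c" and y: "M (L y) = y - c" by (auto simp: algebra_simps)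
    have "M (L (u *\<^sub>R x + v *\<^sub>R y)) + c = u *\<^sub>R (x - c) + v *\<^sub>R (y - c) + c"
      by (simp add: linear_add[OF L] linear_add[OF M] linear_scale[OF L] linear_scale[OF M] x y)
    also have "\<dots> = u *\<^sub>R x + v *\<^sub>R y - (u + v) *\<^sub>R c + c"
      by (simp add: algebra_simps)
    finally show ?case using 1 by simp
  qed
  then have "convex hull V \<subseteq> {x. M (L x) + c = x}"
    using inv by (intro hull_minimal) auto
  then have "inj_on L (convex hull V)"
    by (intro inj_on_inverseI[where g = "\<lambda>y. M y + c"]) auto
  moreover have "L ` (convex hull V) = convex hull W"
    using convex_hull_linear_image[OF L] img by metis
  ultimately have "bij_betw (\<lambda>x. L x + 0) (convex hull V) (convex hull W)"
    by (simp add: bij_betw_def)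
  with L show ?thesis
    unfolding affinely_isomorphic_def by blast
qed

section \<open>Block configurations indexed by a duplicate-free list\<close>

lemma sum_nth_distinct:
  assumes "distinct ts"
  shows "(\<Sum>k<length ts. f (ts ! k)) = sum f (set ts)"
  using assms by (intro sum.reindex_bij_betw bij_betw_nth) auto

lemma configuration_size_map:
  assumes "distinct ts"
  shows "configuration_size (map blk ts) = (\<Sum>t\<in>set ts. card (blk t))"
  using sum_nth_distinct[OF assms, of "\<lambda>t. card (blk t)"]
  by (simp add: configuration_size_def)

text \<open>
  Reading positions through a duplicate-free list \<open>ts\<close> of names turns the vanishing of a vector sum
  over positions into one scalar equation per coordinate, with a sum over the set of names.
\<close>

lemma cyclic_transversal_map:
  assumes "distinct ts" and blk: "\<And>t. t \<in> set ts \<Longrightarrow> blk t \<subseteq> carrier_vec d"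
  shows "cyclic_transversal d (map blk ts) (map u ts) \<longleftrightarrow>
    (\<forall>t\<in>set ts. u t \<in> blk t) \<and> (\<forall>r<d. (\<Sum>t\<in>set ts. u t $ r) = 0)"
proof (cases "\<forall>t\<in>set ts. u t \<in> blk t")
  case True
  let ?f = "\<lambda>k. map u ts ! k" and ?A = "{..<length ts}"
  have "u t \<in> carrier_vec d" if "t \<in> set ts" for t using True blk that by blast
  then have f: "?f \<in> ?A \<rightarrow> carrier_vec d" by simp
  have "finsum_vec TYPE(bit) d ?f ?A = 0\<^sub>v d
      \<longleftrightarrow> (\<forall>r<d. finsum_vec TYPE(bit) d ?f ?A $ r = 0)"
    using finsum_vec_closed[OF f] by (auto intro!: eq_vecI)
  also have "\<dots> \<longleftrightarrow> (\<forall>r<d. (\<Sum>t\<in>set ts. u t $ r) = 0)"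
    using f by (simp add: index_finsum_vec flip: sum_nth_distinct[OF assms(1)])
  finally show ?thesis
    using True by (auto simp: cyclic_transversal_def)
next
  case False
  then show ?thesis
    by (auto simp: cyclic_transversal_def in_set_conv_nth)
qed

lemma ex_map_eq:
  assumes "distinct ts" and "length xs = length ts"
  shows "\<exists>u. xs = map u ts"
proof
  show "xs = map (\<lambda>t. the (map_of (zip ts xs) t)) ts"
    using assms by (auto intro!: nth_equalityI simp: map_of_zip_nth)
qed

section \<open>The block configuration of a set family\<close>

text \<open>
  The list \<open>zs\<close> numbers the coordinates. The list \<open>ts\<close> numbers the blocks, \<open>Inl i\<close> naming the block
  of the member \<open>i\<close> and \<open>Inr e\<close> the block of the ground element \<open>e\<close>. Any orders serve.
\<close>

locale enumerated_set_family =
  fixes I :: "'i set" and H :: "'i \<Rightarrow> 'a set"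
    and zs :: "('i \<times> 'a) list" and ts :: "('i + 'a) list"
  assumes finite_I: "finite I" and I_nonempty: "I \<noteq> {}"
    and finite_H: "\<And>i. i \<in> I \<Longrightarrow> finite (H i)"
    and H_nonempty: "\<And>i. i \<in> I \<Longrightarrow> H i \<noteq> {}"
    and distinct_zs: "distinct zs" and set_zs: "set zs = Sigma I H"
    and distinct_ts: "distinct ts" and set_ts: "set ts = I <+> (\<Union>i\<in>I. H i)"
begin

definition char_vec :: "('i \<times> 'a) set \<Rightarrow> bit vec" where
  "char_vec A = vec (length zs) (\<lambda>r. of_bool (zs ! r \<in> A))"

lemma char_vec_carrier [simp]: "char_vec A \<in> carrier_vec (length zs)"
  by (simp add: char_vec_def)

lemma char_vec_eq_iff:
  assumes "A \<subseteq> Sigma I H" and "A' \<subseteq> Sigma I H"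
  shows "char_vec A = char_vec A' \<longleftrightarrow> A = A'"
proof
  assume eq: "char_vec A = char_vec A'"
  have "z \<in> A \<longleftrightarrow> z \<in> A'" if "z \<in> Sigma I H" for z
  proof -
    from that obtain r where "r < length zs" "zs ! r = z"
      unfolding set_zs[symmetric] by (auto simp: in_set_conv_nth)
    with arg_cong[OF eq, of "\<lambda>v. v $ r"] show ?thesis
      by (simp add: char_vec_def of_bool_def split: if_splits)
  qed
  with assms show "A = A'" by blast
qed simp

text \<open>
  Think of the incidences as entries of a 0/1 matrix with a row for each member and a column for
  each ground element. A line is the row or column in which the vectors of a block are supported.
\<close>

fun line :: "'i + 'a \<Rightarrow> ('i \<times> 'a) set" where
  "line (Inl i) = {i} \<times> UNIV"
| "line (Inr e) = UNIV \<times> {e}"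

fun pieces :: "'i + 'a \<Rightarrow> ('i \<times> 'a) set set" where
  "pieces (Inl i) = {{}, {i} \<times> H i}"
| "pieces (Inr e) = insert {} ((\<lambda>i. {(i, e)}) ` {i \<in> I. e \<in> H i})"

definition blocks :: "bit vec set list" where
  "blocks = map (\<lambda>t. char_vec ` pieces t) ts"

lemma pieces_subset:
  assumes "t \<in> set ts" and "A \<in> pieces t"
  shows "A \<subseteq> Sigma I H" and "A \<subseteq> line t"
proof -
  show "A \<subseteq> line t" using assms(2) by (cases t) auto
  show "A \<subseteq> Sigma I H"
    using assms(1) unfolding set_ts
  proof (elim PlusE)
    fix i assume "i \<in> I" "t = Inl i"
    with assms(2) show ?thesis by auto
  next
    fix e assume "t = Inr e"
    with assms(2) show ?thesis by auto
  qed
qed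

lemma card_block:
  assumes "t \<in> set ts"
  shows "card (char_vec ` pieces t) = card (pieces t)"
proof (rule card_image, rule inj_onI)
  fix A A' assume "A \<in> pieces t" "A' \<in> pieces t" "char_vec A = char_vec A'"
  with pieces_subset(1)[OF assms] show "A = A'" by (simp add: char_vec_eq_iff)
qed

lemma finite_ground: "finite (\<Union>i\<in>I. H i)"
  using finite_I finite_H by blast

text \<open>
  A row block has two vectors, because no member is empty; a column block has one vector more
  than the degree of its element. Counting incidences by columns and by rows, the degrees sum to
  the cardinalities of the members.
\<close>

lemma configuration_size_blocks:
  "configuration_size blocks = 2 * card I + card (\<Union>i\<in>I. H i) + (\<Sum>i\<in>I. card (H i))"
proof -
  let ?E = "\<Union>i\<in>I. H i"
  have set_piece: "card (pieces (Inl i)) = 2" if "i \<in> I" for i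
    using H_nonempty[OF that] by (auto simp: card_insert_if)
  have element_piece: "card (pieces (Inr e)) = 1 + card {i \<in> I. e \<in> H i}" for e
    using finite_I by (subst pieces.simps, subst card_insert_disjoint)
      (auto simp: card_image inj_on_def)
  have "(\<Sum>e\<in>?E. card {i \<in> I. e \<in> H i}) = (\<Sum>e\<in>?E. \<Sum>i | i \<in> I \<and> e \<in> H i. 1)"
    by simp
  also have "\<dots> = (\<Sum>i\<in>I. \<Sum>e | e \<in> ?E \<and> e \<in> H i. 1)"
    by (rule sum.swap_restrict[OF finite_ground finite_I])
  also have "\<dots> = (\<Sum>i\<in>I. card (H i))"
    by (intro sum.cong) (auto intro!: arg_cong[where f = card])
  finally have degrees: "(\<Sum>e\<in>?E. card {i \<in> I. e \<in> H i}) = (\<Sum>i\<in>I. card (H i))" .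
  have "configuration_size blocks = (\<Sum>t\<in>I <+> ?E. card (pieces t))"
    unfolding blocks_def configuration_size_map[OF distinct_ts] set_ts
    by (intro sum.cong refl card_block) (simp add: set_ts)
  also have "\<dots> = (\<Sum>i\<in>I. card (pieces (Inl i))) + (\<Sum>e\<in>?E. card (pieces (Inr e)))"
    by (simp add: sum.Plus finite_I finite_ground del: pieces.simps)
  also have "\<dots> = (\<Sum>i\<in>I. 2) + (\<Sum>e\<in>?E. 1 + card {i \<in> I. e \<in> H i})"
    using set_piece element_piece by simp
  finally show ?thesis
    by (simp only: sum.distrib degrees) simp
qed

lemma length_blocks: "length blocks = card I + card (\<Union>i\<in>I. H i)"
  using distinct_card[OF distinct_ts]
  by (simp add: blocks_def set_ts card_Plus finite_I finite_ground)

lemma block_configuration_blocks: "block_configuration (length zs) blocks"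
proof -
  obtain i e where "i \<in> I" "e \<in> H i"
    using I_nonempty H_nonempty by blast
  then have "(i, e) \<in> set zs" and "0 < card I" and "0 < card (\<Union>i\<in>I. H i)"
    using finite_I finite_ground by (auto simp: set_zs card_gt_0_iff)
  then have "1 \<le> length zs" and "2 \<le> length blocks"
    by (auto simp: length_blocks Suc_le_eq intro: length_pos_if_in_set)
  moreover have "pieces t \<noteq> {}" for t by (cases t) auto
  ultimately show ?thesis
    by (auto simp: block_configuration_def blocks_def)
qed

section \<open>Cyclic transversals are packings\<close>

text \<open>
  Only the row and the column through \<open>(i, e)\<close> can contain this incidence, so the coordinate
  equation has two summands, and a sum of two bits is zero iff they are equal.
\<close>

lemma cyclic_transversal_char_vec_iff:
  assumes W: "\<And>t. t \<in> set ts \<Longrightarrow> W t \<in> pieces t"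
  shows "cyclic_transversal (length zs) blocks (map (\<lambda>t. char_vec (W t)) ts) \<longleftrightarrow>
    (\<forall>i\<in>I. \<forall>e\<in>H i. (i, e) \<in> W (Inl i) \<longleftrightarrow> (i, e) \<in> W (Inr e))"
proof -
  let ?E = "\<Union>i\<in>I. H i"
  have coordinate: "(\<Sum>t\<in>set ts. of_bool ((i, e) \<in> W t) :: bit) = 0
      \<longleftrightarrow> ((i, e) \<in> W (Inl i) \<longleftrightarrow> (i, e) \<in> W (Inr e))" if ie: "(i, e) \<in> Sigma I H" for i e
  proof -
    let ?p = "\<lambda>t. of_bool ((i, e) \<in> W t) :: bit"
    have zero: "?p t = 0" if "t \<in> set ts" "t \<notin> {Inl i, Inr e}" for t
      using pieces_subset(2)[OF that(1) W[OF that(1)]] that(2) by (cases t) auto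
    have "sum ?p (set ts) = sum ?p {Inl i, Inr e}"
      using ie zero by (intro sum.mono_neutral_right) (auto simp: set_ts finite_I finite_ground)
    then show ?thesis by (simp del: sum_of_bool_eq)
  qed
  have "cyclic_transversal (length zs) blocks (map (\<lambda>t. char_vec (W t)) ts) \<longleftrightarrow>
      (\<forall>r<length zs. (\<Sum>t\<in>set ts. char_vec (W t) $ r) = 0)"
    unfolding blocks_def using W by (subst cyclic_transversal_map[OF distinct_ts]) auto
  also have "\<dots> \<longleftrightarrow> (\<forall>r<length zs. (\<Sum>t\<in>set ts. of_bool (zs ! r \<in> W t) :: bit) = 0)"
    by (simp add: char_vec_def)
  also have "\<dots> \<longleftrightarrow> (\<forall>z\<in>Sigma I H. (\<Sum>t\<in>set ts. of_bool (z \<in> W t) :: bit) = 0)"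
    unfolding set_zs[symmetric] by (auto simp: all_set_conv_all_nth simp del: sum_of_bool_eq)
  also have "\<dots> \<longleftrightarrow> (\<forall>i\<in>I. \<forall>e\<in>H i. (i, e) \<in> W (Inl i) \<longleftrightarrow> (i, e) \<in> W (Inr e))"
    using coordinate by auto
  finally show ?thesis .
qed

text \<open>
  Every block receives the part of the rows of \<open>S\<close> that lies on its line: the rows of the members
  of \<open>S\<close>, the empty set for the other members, and in a column the incidences of members of \<open>S\<close>.
\<close>

definition selection :: "'i set \<Rightarrow> bit vec list" where
  "selection S = map (\<lambda>t. char_vec (Sigma S H \<inter> line t)) ts"

lemma packing_at_most_one:
  assumes "packing I H S" and "i \<in> S" and "j \<in> S"
    and "Sigma {i} H \<inter> line t \<noteq> {}" and "Sigma {j} H \<inter> line t \<noteq> {}"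
  shows "i = j"
proof (cases t)
  case (Inr e)
  with assms have "e \<in> H i \<inter> H j" by auto
  with assms show ?thesis by (auto simp: packing_def disjoint_family_on_def)
qed (use assms in auto)

text \<open>
  Disjointness is what makes the selection admissible in the columns: the block of an element
  offers at most one incidence at a time.
\<close>

lemma packing_line_piece:
  assumes "packing I H S"
  shows "Sigma S H \<inter> line t \<in> pieces t"
proof (cases t)
  case (Inl i)
  then show ?thesis by auto
next
  case (Inr e)
  show ?thesis
  proof (cases "\<exists>i\<in>S. e \<in> H i")
    case True
    then obtain i where i: "i \<in> S" "e \<in> H i" by blast
    with packing_at_most_one[OF assms, of i _ t] Inr
    have "Sigma S H \<inter> line t = {(i, e)}" by auto
    with Inr i assms show ?thesis by (auto simp: packing_def)
  qed (use Inr in auto)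
qed

lemma cyclic_transversal_iff_packing:
  "cyclic_transversal (length zs) blocks \<xi> \<longleftrightarrow> (\<exists>S. packing I H S \<and> \<xi> = selection S)"
proof
  assume ct: "cyclic_transversal (length zs) blocks \<xi>"
  then have "length \<xi> = length ts" by (simp add: cyclic_transversal_def blocks_def)
  then obtain u where u: "\<xi> = map u ts" using ex_map_eq[OF distinct_ts] by blast
  have "u t \<in> char_vec ` pieces t" if "t \<in> set ts" for t
    using that ct by (force simp: cyclic_transversal_def blocks_def u in_set_conv_nth)
  then have "\<forall>t. \<exists>A. t \<in> set ts \<longrightarrow> A \<in> pieces t \<and> u t = char_vec A" by blast
  then obtain W where W: "\<And>t. t \<in> set ts \<Longrightarrow> W t \<in> pieces t"
    and uW: "\<And>t. t \<in> set ts \<Longrightarrow> u t = char_vec (W t)"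
    by metis
  have \<xi>: "\<xi> = map (\<lambda>t. char_vec (W t)) ts" by (simp add: u uW)
  \<comment> \<open>The members whose row is chosen; the agreement of rows and columns forces all other choices.\<close>
  define S where "S = {i \<in> I. W (Inl i) \<noteq> {}}"
  have "\<forall>i\<in>I. \<forall>e\<in>H i. (i, e) \<in> W (Inl i) \<longleftrightarrow> (i, e) \<in> W (Inr e)"
    using ct W unfolding \<xi> by (subst (asm) cyclic_transversal_char_vec_iff) auto
  then have match: "(i, e) \<in> W (Inl i) \<longleftrightarrow> (i, e) \<in> W (Inr e)" if "i \<in> I" "e \<in> H i" for i e
    using that by blast
  have WI: "W (Inl i) = Sigma S H \<inter> line (Inl i)" if "i \<in> I" for i
  proof -
    from W[of "Inl i"] that have "W (Inl i) = {} \<or> W (Inl i) = {i} \<times> H i"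
      by (auto simp: set_ts)
    with that show ?thesis by (elim disjE) (auto simp: S_def)
  qed
  have WE: "W (Inr e) = Sigma S H \<inter> line (Inr e)" if "e \<in> (\<Union>i\<in>I. H i)" for e
  proof -
    have "Inr e \<in> set ts" using that unfolding set_ts by (rule InrI)
    note sub = pieces_subset[OF this W[OF this]]
    have at_e: "(i, e) \<in> W (Inr e) \<longleftrightarrow> (i, e) \<in> Sigma S H" for i
    proof (cases "(i, e) \<in> Sigma I H")
      case True
      then show ?thesis using match[of i e] WI[of i] by simp
    next
      case False
      then show ?thesis using sub(1) by (auto simp: S_def)
    qed
    have "z \<in> W (Inr e) \<longleftrightarrow> z \<in> Sigma S H \<inter> line (Inr e)" for z
    proof (cases "snd z = e")
      case True
      then show ?thesis using at_e[of "fst z"] by (cases z) simp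
    next
      case False
      then have "z \<notin> line (Inr e)" by (cases z) simp
      then show ?thesis using sub(2) by blast
    qed
    then show ?thesis by blast
  qed
  \<comment> \<open>Two taken members that share \<open>e\<close> would both occupy it, but pieces of a column have at most one element.\<close>
  have "i = j" if "i \<in> S" "j \<in> S" "e \<in> H i" "e \<in> H j" for i j e
  proof -
    have e: "e \<in> (\<Union>i\<in>I. H i)" using that by (auto simp: S_def)
    have "(i, e) \<in> W (Inr e)" "(j, e) \<in> W (Inr e)" unfolding WE[OF e] using that by auto
    moreover have "W (Inr e) \<in> pieces (Inr e)"
      using W e by (simp add: set_ts InrI del: pieces.simps)
    ultimately show "i = j" by auto
  qed
  then have "packing I H S"
    by (auto simp: packing_def disjoint_family_on_def S_def)
  moreover have "\<xi> = selection S"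
    unfolding \<xi> selection_def
  proof (rule map_cong[OF refl])
    fix t assume "t \<in> set ts"
    then show "char_vec (W t) = char_vec (Sigma S H \<inter> line t)"
      unfolding set_ts using WI WE by (elim PlusE) metis+
  qed
  ultimately show "\<exists>S. packing I H S \<and> \<xi> = selection S" by blast
next
  assume "\<exists>S. packing I H S \<and> \<xi> = selection S"
  then show "cyclic_transversal (length zs) blocks \<xi>"
    by (auto simp: selection_def packing_line_piece cyclic_transversal_char_vec_iff)
qed

section \<open>The affine isomorphism\<close>

lemma transversal_vector_map:
  "transversal_vector (map u ts) = (\<Sum>k<length ts. Poly_Mapping.single (k, u (ts ! k)) 1)"
proof -
  have "{(k, map u ts ! k) |k. k < length (map u ts)} = (\<lambda>k. (k, u (ts ! k))) ` {..<length ts}"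
    by auto
  then show ?thesis
    by (simp add: transversal_vector_def incidence_vector_def sum.reindex inj_on_def)
qed

text \<open>
  The identity holds block by block: a line meets the row of at most one member of \<open>S\<close>, and on
  that line \<open>S\<close> and this member alone select the same vector, while the differences of all other
  members vanish.
\<close>

lemma transversal_vector_selection:
  assumes S: "packing I H S"
  shows "transversal_vector (selection S) = transversal_vector (selection {}) +
    (\<Sum>i\<in>S. transversal_vector (selection {i}) - transversal_vector (selection {}))"
proof -
  have finite_S: "finite S"
    using S finite_I finite_subset by (auto simp: packing_def)
  define F :: "nat \<Rightarrow> ('i \<times> 'a) set \<Rightarrow> (nat \<times> bit vec \<Rightarrow>\<^sub>0 real)"
    where "F k A = Poly_Mapping.single (k, char_vec A) 1" for k A
  have tv: "transversal_vector (selection S') = (\<Sum>k<length ts. F k (Sigma S' H \<inter> line (ts ! k)))"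
    for S'
    by (simp add: selection_def transversal_vector_map F_def)
  have block: "F k (Sigma S H \<inter> line t) - F k {} = (\<Sum>i\<in>S. F k (Sigma {i} H \<inter> line t) - F k {})"
    for k t
  proof (cases "\<exists>i\<in>S. Sigma {i} H \<inter> line t \<noteq> {}")
    case True
    then obtain i where i: "i \<in> S" "Sigma {i} H \<inter> line t \<noteq> {}" by blast
    have others: "Sigma {j} H \<inter> line t = {}" if "j \<in> S - {i}" for j
      using packing_at_most_one[OF S i(1) _ i(2), of j] that by blast
    have "(\<Sum>j\<in>S. F k (Sigma {j} H \<inter> line t) - F k {})
        = (\<Sum>j\<in>{i}. F k (Sigma {j} H \<inter> line t) - F k {})"
      using finite_S i(1) others by (intro sum.mono_neutral_right) auto
    moreover have "Sigma S H \<inter> line t = Sigma {i} H \<inter> line t"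
      using others i(1) by blast
    ultimately show ?thesis by simp
  next
    case False
    then have "Sigma S H \<inter> line t = {}" by blast
    with False show ?thesis by simp
  qed
  have "transversal_vector (selection S) - transversal_vector (selection {})
      = (\<Sum>k<length ts. F k (Sigma S H \<inter> line (ts ! k)) - F k {})"
    by (simp add: tv sum_subtractf)
  also have "\<dots> = (\<Sum>k<length ts. \<Sum>i\<in>S. F k (Sigma {i} H \<inter> line (ts ! k)) - F k {})"
    by (simp only: block)
  also have "\<dots> = (\<Sum>i\<in>S. \<Sum>k<length ts. F k (Sigma {i} H \<inter> line (ts ! k)) - F k {})"
    by (rule sum.swap)
  also have "\<dots> = (\<Sum>i\<in>S. transversal_vector (selection {i}) - transversal_vector (selection {}))"
    by (simp add: tv sum_subtractf)
  finally show ?thesis by (simp add: algebra_simps)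
qed

lemma lookup_transversal_vector_selection:
  assumes "k < length ts" and "ts ! k = Inl i" and "i \<in> I" and "S \<subseteq> I"
  shows "Poly_Mapping.lookup (transversal_vector (selection S)) (k, char_vec ({i} \<times> H i))
    = of_bool (i \<in> S)"
proof -
  have "Poly_Mapping.lookup (transversal_vector (selection S)) (k, char_vec ({i} \<times> H i))
      = of_bool (char_vec ({i} \<times> H i) = char_vec (Sigma S H \<inter> line (Inl i)))"
    using assms(1,2)
    by (auto simp: transversal_vector_def lookup_incidence_vector selection_def)
  also have "\<dots> = of_bool ({i} \<times> H i = Sigma S H \<inter> line (Inl i))"
    using assms(3,4) by (subst char_vec_eq_iff) auto
  also have "\<dots> = of_bool (i \<in> S)"
    using H_nonempty[OF assms(3)] by auto
  finally show ?thesis .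
qed

text \<open>
  A sum over the members of a packing is thus a linear function of its incidence vector, which
  applies both to the incidence vector itself and to the sum of difference vectors above.
\<close>

lemma lookup_sum_packing:
  assumes "packing I H S"
  shows "(\<Sum>i\<in>I. Poly_Mapping.lookup (incidence_vector S) i *\<^sub>R v i)
    = (\<Sum>i\<in>S. v i :: 'b::real_vector)"
proof -
  have S: "S \<subseteq> I" "finite S"
    using assms finite_I finite_subset by (auto simp: packing_def)
  then have "(\<Sum>i\<in>S. v i) = (\<Sum>i\<in>I. if i \<in> S then v i else 0)"
    by (simp add: sum.If_cases finite_I Int_absorb1)
  also have "\<dots> = (\<Sum>i\<in>I. Poly_Mapping.lookup (incidence_vector S) i *\<^sub>R v i)"
    using S by (intro sum.cong) (auto simp: lookup_incidence_vector)
  finally show ?thesis by simp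
qed

lemma CTP_affinely_isomorphic_PACK:
  "affinely_isomorphic (CTP (length zs) blocks) (PACK I H)"
proof -
  have "\<exists>k<length ts. ts ! k = Inl i" if "i \<in> I" for i
    using that set_ts by (metis InlI in_set_conv_nth)
  then obtain pos where pos: "\<And>i. i \<in> I \<Longrightarrow> pos i < length ts"
    "\<And>i. i \<in> I \<Longrightarrow> ts ! pos i = Inl i"
    by metis
  \<comment> \<open>\<open>L\<close> reads off which rows are chosen; \<open>M\<close> is the linear part of the affine inverse.\<close>
  define L :: "(nat \<times> bit vec \<Rightarrow>\<^sub>0 real) \<Rightarrow> ('i \<Rightarrow>\<^sub>0 real)" where
    "L x = (\<Sum>i\<in>I. Poly_Mapping.lookup x (pos i, char_vec ({i} \<times> H i)) *\<^sub>R Poly_Mapping.single i 1)"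
    for x
  define M :: "('i \<Rightarrow>\<^sub>0 real) \<Rightarrow> (nat \<times> bit vec \<Rightarrow>\<^sub>0 real)" where
    "M y = (\<Sum>i\<in>I. Poly_Mapping.lookup y i *\<^sub>R
      (transversal_vector (selection {i}) - transversal_vector (selection {})))" for y
  define P where "P = {S. packing I H S}"
  have vertices: "transversal_vector ` {\<xi>. cyclic_transversal (length zs) blocks \<xi>}
      = (\<lambda>S. transversal_vector (selection S)) ` P"
    by (auto simp: cyclic_transversal_iff_packing P_def)
  have L_vertex: "L (transversal_vector (selection S)) = incidence_vector S" if "S \<in> P" for S
  proof -
    have S: "packing I H S" "S \<subseteq> I" "finite S"
      using that finite_I finite_subset by (auto simp: P_def packing_def)
    have "L (transversal_vector (selection S))
        = (\<Sum>i\<in>I. Poly_Mapping.lookup (incidence_vector S) i *\<^sub>R Poly_Mapping.single i 1)"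
      unfolding L_def using S
      by (intro sum.cong) (auto simp: lookup_transversal_vector_selection pos lookup_incidence_vector)
    also have "\<dots> = incidence_vector S"
      unfolding lookup_sum_packing[OF S(1)] by (simp add: incidence_vector_def)
    finally show ?thesis .
  qed
  show ?thesis
    unfolding CTP_def PACK_def vertices P_def[symmetric]
  proof (rule affinely_isomorphic_convex_hulls[where L = L and M = M
        and c = "transversal_vector (selection {})"])
    show "linear L" unfolding L_def by (rule linear_sum_lookup)
    show "linear M" unfolding M_def by (rule linear_sum_lookup)
    show "L ` (\<lambda>S. transversal_vector (selection S)) ` P = incidence_vector ` P"
      by (simp add: image_image L_vertex)
    show "M (L v) + transversal_vector (selection {}) = v"
      if "v \<in> (\<lambda>S. transversal_vector (selection S)) ` P" for v
    proof -
      from that obtain S where S: "S \<in> P" "v = transversal_vector (selection S)" by blast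
      then have packing: "packing I H S" by (simp add: P_def)
      have "M (L v) = (\<Sum>i\<in>S.
          transversal_vector (selection {i}) - transversal_vector (selection {}))"
        unfolding S(2) L_vertex[OF S(1)] M_def by (rule lookup_sum_packing[OF packing])
      with transversal_vector_selection[OF packing] show ?thesis
        by (simp only: S(2) add.commute)
    qed
  qed
qed

end

section \<open>Set-packing polytopes as cyclic transversal polytopes\<close>

theorem theorem3p8:
  fixes I :: "'i set" and H :: "'i \<Rightarrow> 'a set"
  assumes "finite I" and "I \<noteq> {}"
    and "\<And>i. i \<in> I \<Longrightarrow> finite (H i)"
    and "\<And>i. i \<in> I \<Longrightarrow> H i \<noteq> {}"
  shows "\<exists>d B. block_configuration d B
           \<and> length B = card I + card (\<Union>i\<in>I. H i)
           \<and> configuration_size B = 2 * card I + card (\<Union>i\<in>I. H i) + (\<Sum>i\<in>I. card (H i))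
           \<and> affinely_isomorphic (CTP d B) (PACK I H)"
proof -
  have "finite (Sigma I H)" and "finite (I <+> (\<Union>i\<in>I. H i))"
    using assms by auto
  then obtain zs ts where "distinct zs" "set zs = Sigma I H"
    and "distinct ts" "set ts = I <+> (\<Union>i\<in>I. H i)"
    by (metis finite_distinct_list)
  with assms interpret enumerated_set_family I H zs ts
    by unfold_locales
  show ?thesis
    using block_configuration_blocks length_blocks configuration_size_blocks
      CTP_affinely_isomorphic_PACK by blast
qed

end
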